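(* Let $A\in\mathbb{C}^{m\times n}$, $B\in\mathbb{C}^{p\times q}$, $C\in\mathbb{C}^{m\times q}$, and let $A^{(1)}$ and $B^{(1)}$ be $\{1\}$-inverses of $A$ and $B$. If $X_0\in\mathbb{C}^{n\times p}$ is any particular solution of the matrix equation $AXB=C$, then the general solution of the matrix equation $AXB=C$ is given by the formula $$X=g(Y)=X_0+Y-A^{(1)}AYBB^{(1)},$$ where $Y\in\mathbb{C}^{n\times p}$ is an arbitrary matrix. The function $g$ satisfies the condition of reproductivity $g\circ g=g$ if and only if $X_0=A^{(1)}CB^{(1)}$.
   Context: A $\{1\}$-inverse of a matrix $M\in\mathbb{C}^{m\times n}$ is any matrix $M^{(1)}\in\mathbb{C}^{n\times m}$ with $MM^{(1)}M=M$. For a function $\phi:S\to S$, the formula $x=\phi(t)$ represents the general solution of an equation $J(x)$ on $S$ if $\phi(t)$ is a solution for every $t\in S$ and every solution $x$ is of the form $x=\phi(t)$ for some $t\in S$; here $S=\mathbb{C}^{n\times p}$. *)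

theory Defs
  imports "HOL-Analysis.Analysis"
begin

text \<open>An \<open>m \<times> n\<close> complex matrix has type \<open>complex ^ 'n ^ 'm\<close>: the row index is the outer one.\<close>

definition one_inverse :: "complex ^ 'n ^ 'm \<Rightarrow> complex ^ 'm ^ 'n \<Rightarrow> bool" where
  "one_inverse M M1 \<longleftrightarrow> M ** M1 ** M = M"

text \<open>The underlying set \<open>S\<close> of the equation \<open>J\<close> is the type \<open>'s\<close>; both the parameter and
  the solutions range over it.\<close>

definition represents_general_solution :: "('s \<Rightarrow> 's) \<Rightarrow> ('s \<Rightarrow> bool) \<Rightarrow> bool" where
  "represents_general_solution \<phi> J \<longleftrightarrow> (\<forall>t. J (\<phi> t)) \<and> (\<forall>x. J x \<longrightarrow> (\<exists>t. x = \<phi> t))"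

end

theory Submission
  imports Defs
begin

text \<open>
  Write \<open>P Y = A1 A Y B B1\<close>, so that \<open>g Y = X0 + Y - P Y\<close>. The two inverse laws give
  \<open>A (P Y) B = A Y B\<close> (lemma \<open>one_inverse_sandwich\<close>). Hence the correction \<open>Y - P Y\<close> lies in the
  kernel of \<open>X \<mapsto> A X B\<close>, and \<open>g\<close> takes only solutions as values. Conversely \<open>P Y\<close> depends on \<open>Y\<close>
  through \<open>A Y B\<close> alone, so \<open>P\<close> sends the difference of two solutions to \<open>0\<close>; a solution \<open>X\<close> is
  therefore the value of \<open>g\<close> at \<open>X - X0\<close>.

  For reproductivity, \<open>g Y\<close> is a solution, whence \<open>P (g Y) = A1 C B1\<close> and
  \<open>g (g Y) = g Y + (X0 - A1 C B1)\<close>. Thus \<open>g \<circ> g\<close> differs from \<open>g\<close> by a constant, which vanishes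
  exactly when \<open>X0 = A1 C B1\<close>.
\<close>

lemma matrix_add_rdistrib: "(A + B) ** C = A ** C + B ** C"
  by (vector matrix_matrix_mult_def sum.distrib[symmetric] distrib_right)

lemma matrix_diff_ldistrib:
  fixes A :: "'a::ring_1 ^ 'n ^ 'm"
  shows "A ** (B - C) = A ** B - A ** C"
  by (vector matrix_matrix_mult_def sum_subtractf[symmetric] right_diff_distrib)

lemma matrix_diff_rdistrib:
  fixes A B :: "'a::ring_1 ^ 'n ^ 'm"
  shows "(A - B) ** C = A ** C - B ** C"
  by (vector matrix_matrix_mult_def sum_subtractf[symmetric] left_diff_distrib)

lemma one_inverse_sandwich:
  fixes A :: "complex ^ 'n ^ 'm" and B :: "complex ^ 'q ^ 'p" and Y :: "complex ^ 'p ^ 'n"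
  assumes "one_inverse A A1" and "one_inverse B B1"
  shows "A ** (A1 ** A ** Y ** B ** B1) ** B = A ** Y ** B"
proof -
  have "A ** (A1 ** A ** Y ** B ** B1) ** B = (A ** A1 ** A) ** Y ** (B ** B1 ** B)"
    by (simp add: matrix_mul_assoc)
  with assms show ?thesis
    by (simp add: one_inverse_def)
qed

theorem theorem2p9:
  fixes A :: "complex ^ 'n ^ 'm"
    and B :: "complex ^ 'q ^ 'p"
    and C :: "complex ^ 'q ^ 'm"
    and A1 :: "complex ^ 'm ^ 'n"
    and B1 :: "complex ^ 'p ^ 'q"
    and X0 :: "complex ^ 'p ^ 'n"
  assumes "one_inverse A A1"
    and "one_inverse B B1"
    and "A ** X0 ** B = C"
  shows "let g = (\<lambda>Y :: complex ^ 'p ^ 'n. X0 + Y - A1 ** A ** Y ** B ** B1)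
         in represents_general_solution g (\<lambda>X. A ** X ** B = C)
            \<and> (g \<circ> g = g \<longleftrightarrow> X0 = A1 ** C ** B1)"
proof -
  define g where "g = (\<lambda>Y :: complex ^ 'p ^ 'n. X0 + Y - A1 ** A ** Y ** B ** B1)"
  have P: "A1 ** A ** Y ** B ** B1 = A1 ** (A ** Y ** B) ** B1" for Y
    by (simp add: matrix_mul_assoc)
  have solution: "A ** g Y ** B = C" for Y
  proof -
    have "A ** g Y ** B
        = A ** X0 ** B + A ** Y ** B - A ** (A1 ** A ** Y ** B ** B1) ** B"
      by (simp only: g_def matrix_add_ldistrib matrix_add_rdistrib
            matrix_diff_ldistrib matrix_diff_rdistrib)
    with assms(3) show ?thesis
      by (simp only: one_inverse_sandwich[OF assms(1,2)] add_diff_cancel_right')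
  qed
  have surjective: "X = g (X - X0)" if "A ** X ** B = C" for X
  proof -
    have "A ** (X - X0) ** B = 0"
      using that assms(3) by (simp add: matrix_diff_ldistrib matrix_diff_rdistrib)
    then show ?thesis
      by (simp add: g_def P)
  qed
  have "g (g Y) = X0 + g Y - A1 ** (A ** g Y ** B) ** B1" for Y
    by (subst (1) g_def) (simp only: P)
  then have twice: "g (g Y) = g Y + (X0 - A1 ** C ** B1)" for Y
    by (simp add: solution)
  have "g \<circ> g = g \<longleftrightarrow> X0 = A1 ** C ** B1"
    by (simp add: fun_eq_iff twice)
  moreover have "represents_general_solution g (\<lambda>X. A ** X ** B = C)"
    using solution surjective unfolding represents_general_solution_def by blast
  ultimately show ?thesis
    by (simp add: Let_def flip: g_def)
qed

end
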